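(* Let $Z\in\{T,B,L,A\}$. For $n\ge1$ let $\mathcal{F}_n^2$ be the set of forests of $n$ binary shrubs with label set $\{1,\ldots,3n\}$, and let $\mathrm{IZF}_n^2$ be the number of $F=(F_1,\ldots,F_n)\in\mathcal{F}_n^2$ with $F_1<_Z F_2<_Z\cdots<_Z F_n$. For $F\in\mathcal{F}_n^2$ let $\mathrm{risZ}(F)=|\{i\in\{1,\ldots,n-1\}:F_i<_Z F_{i+1}\}|$. Then $$\mathcal{RZ}(x,t):=1+\sum_{n\ge1}\frac{t^{3n}}{(3n)!}\sum_{F\in\mathcal{F}_n^2}x^{\mathrm{risZ}(F)}=\frac{1}{1-\sum_{n\ge1}\frac{t^{3n}}{(3n)!}(x-1)^{n-1}\mathrm{IZF}_n^2}.$$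
   Context: A binary shrub is a tree consisting of a root with an ordered pair of children (left and right), labeled by distinct positive integers so that the root's label is smaller than both children's labels; its word is (root, left child, right child). A forest of $n$ binary shrubs with label set $\{1,\ldots,3n\}$ is an ordered sequence $F=(F_1,\ldots,F_n)$ of binary shrubs whose labels together are exactly $\{1,\ldots,3n\}$, each used once. For two shrubs with words $abc$ and $def$: $abc<_T def$ if every element of $\{a,b,c\}$ is less than every element of $\{d,e,f\}$; $abc<_B def$ if $a<d$; $abc<_L def$ if $a<d$, $b<e$ and $c<f$; $abc<_A def$ if $c<e$. *)

theory Defs
  imports "HOL-Computational_Algebra.Formal_Power_Series"
begin

datatype shrub = Shrub (root: nat) (left: nat) (right: nat)

fun word :: "shrub \<Rightarrow> nat list" where
  "word (Shrub a b c) = [a, b, c]"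

definition binary_shrub :: "shrub \<Rightarrow> bool" where
  "binary_shrub s \<longleftrightarrow>
     distinct (word s) \<and> (\<forall>k\<in>set (word s). 0 < k) \<and> root s < left s \<and> root s < right s"

definition forests :: "nat \<Rightarrow> shrub list set" where
  "forests n = {F. length F = n \<and> (\<forall>s\<in>set F. binary_shrub s) \<and>
                   distinct (concat (map word F)) \<and> set (concat (map word F)) = {1..3 * n}}"

datatype shrub_order = Ord_T | Ord_B | Ord_L | Ord_A

fun shrub_less :: "shrub_order \<Rightarrow> shrub \<Rightarrow> shrub \<Rightarrow> bool" where
  "shrub_less Ord_T s s' \<longleftrightarrow> (\<forall>k\<in>set (word s). \<forall>l\<in>set (word s'). k < l)"
| "shrub_less Ord_B s s' \<longleftrightarrow> root s < root s'"
| "shrub_less Ord_L s s' \<longleftrightarrow> root s < root s' \<and> left s < left s' \<and> right s < right s'"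
| "shrub_less Ord_A s s' \<longleftrightarrow> right s < left s'"

text \<open>List positions count from 0, so the index \<open>i\<close> below corresponds to the pair
  $(F_{i+1}, F_{i+2})$ of the forest $(F_1, \dots, F_n)$.\<close>

definition ris :: "shrub_order \<Rightarrow> shrub list \<Rightarrow> nat" where
  "ris Z F = card {i. i + 1 < length F \<and> shrub_less Z (F ! i) (F ! (i + 1))}"

text \<open>Only consecutive shrubs are compared in an increasing forest; this matters because
  the relation for \<^const>\<open>Ord_A\<close> is not transitive.\<close>

definition IZF :: "shrub_order \<Rightarrow> nat \<Rightarrow> nat" where
  "IZF Z n = card {F \<in> forests n. \<forall>i. i + 1 < n \<longrightarrow> shrub_less Z (F ! i) (F ! (i + 1))}"

text \<open>The formal power series $\sum_{n \ge 1} c_n \, t^{3n} / (3n)!$ in $t$.\<close>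

definition egf3 :: "(nat \<Rightarrow> 'a::field_char_0) \<Rightarrow> 'a fps" where
  "egf3 c = Abs_fps (\<lambda>m. if 0 < m \<and> 3 dvd m then c (m div 3) / fact m else 0)"

end

theory Submission
  imports Defs "HOL-Library.Infinite_Set"
begin

text \<open>
  Expand \<open>x\<^bsup>ris F\<^esup> = \<Prod>(1 + (x - 1)[F\<^sub>i < F\<^sub>i\<^sub>+\<^sub>1])\<close> over the adjacent pairs of a nonempty forest and sort
  the terms by the length \<open>k\<close> of the initial run of chosen rises:
  \<open>x\<^bsup>ris F\<^esup>\<close> is the sum of \<open>(x - 1)\<^bsup>k - 1\<^esup> x\<^bsup>ris (drop k F)\<^esup>\<close> over those \<open>k \<ge> 1\<close> for which the first
  \<open>k\<close> shrubs are increasing. Splitting a forest after its \<open>k\<close>th shrub distributes the labels over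
  two smaller forests, and all four orders depend only on the relative order of the labels; so
  summing over all forests gives the recurrence
  \<open>a\<^sub>n = \<Sum>\<^sub>k (3n choose 3k) (x - 1)\<^bsup>k - 1\<^esup> IZF\<^sub>k a\<^sub>n\<^sub>-\<^sub>k\<close>, which is the claimed identity of series.
\<close>

section \<open>Forests over an arbitrary label set\<close>

definition labels :: "shrub list \<Rightarrow> nat set" where
  "labels F = set (concat (map word F))"

text \<open>Cutting a forest in two leaves label sets that need not be initial intervals, hence an
  arbitrary \<open>S\<close>. No length is prescribed: three labels per shrub without repetition
  force it to be \<open>card S div 3\<close>.\<close>

definition forests_on :: "nat set \<Rightarrow> shrub list set" where
  "forests_on S = {F. (\<forall>s\<in>set F. binary_shrub s) \<and> distinct (concat (map word F)) \<and> labels F = S}"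

definition relabel :: "(nat \<Rightarrow> nat) \<Rightarrow> shrub \<Rightarrow> shrub" where
  "relabel h s = Shrub (h (root s)) (h (left s)) (h (right s))"

lemma relabel_sel [simp]:
  "root (relabel h s) = h (root s)"
  "left (relabel h s) = h (left s)"
  "right (relabel h s) = h (right s)"
  by (simp_all add: relabel_def)

lemma word_eq: "word s = [root s, left s, right s]"
  by (cases s) simp

lemma word_relabel [simp]: "word (relabel h s) = map h (word s)"
  by (simp add: word_eq)

lemma concat_word_relabel:
  "concat (map word (map (relabel h) F)) = map h (concat (map word F))"
  by (induction F) simp_all

lemma labels_relabel: "labels (map (relabel h) F) = h ` labels F"
  by (simp only: labels_def concat_word_relabel set_map)

lemma set_word_subset_labels: "s \<in> set F \<Longrightarrow> set (word s) \<subseteq> labels F"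
  by (auto simp: labels_def)

lemma length_concat_word: "length (concat (map word F)) = 3 * length F"
  by (induction F) (simp_all add: word_eq)

lemma length_forests_on:
  assumes "F \<in> forests_on S"
  shows "3 * length F = card S"
proof -
  have "card (labels F) = length (concat (map word F))"
    using assms unfolding labels_def forests_on_def by (intro distinct_card) simp
  with assms show ?thesis
    unfolding length_concat_word by (simp add: forests_on_def)
qed

lemma forests_eq_forests_on: "forests n = forests_on {1..3 * n}"
proof
  show "forests n \<subseteq> forests_on {1..3 * n}"
    by (auto simp: forests_def forests_on_def labels_def)
  show "forests_on {1..3 * n} \<subseteq> forests n"
  proof
    fix F assume F: "F \<in> forests_on {1..3 * n}"
    then have "length F = n" using length_forests_on[OF F] by simp
    with F show "F \<in> forests n" by (simp add: forests_def forests_on_def labels_def)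
  qed
qed

lemma finite_forests_on:
  assumes "finite S"
  shows "finite (forests_on S)"
proof (rule finite_subset)
  let ?A = "(\<lambda>(a, b, c). Shrub a b c) ` (S \<times> S \<times> S)"
  show "finite {F. set F \<subseteq> ?A \<and> length F = card S div 3}"
    using assms by (intro finite_lists_length_eq) auto
  show "forests_on S \<subseteq> {F. set F \<subseteq> ?A \<and> length F = card S div 3}"
  proof (intro subsetI CollectI conjI)
    fix F assume F: "F \<in> forests_on S"
    show "length F = card S div 3" using length_forests_on[OF F] by simp
    fix s assume "s \<in> set F"
    then have "set (word s) \<subseteq> S"
      using F set_word_subset_labels by (fastforce simp: forests_on_def)
    then show "s \<in> ?A" by (cases s) force
  qed
qed

section \<open>Invariance under increasing relabelling\<close>

text \<open>Each of the four orders is a conjunction of comparisons between labels, and an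
  increasing \<open>h\<close> preserves and reflects every such comparison.\<close>

lemma shrub_less_relabel:
  assumes h: "strict_mono_on S h" and "set (word s) \<subseteq> S" "set (word s') \<subseteq> S"
  shows "shrub_less Z (relabel h s) (relabel h s') \<longleftrightarrow> shrub_less Z s s'"
proof -
  have "h a < h b \<longleftrightarrow> a < b" if "a \<in> S" "b \<in> S" for a b
    using strict_mono_on_less[OF h] that by blast
  then show ?thesis using assms(2,3) by (cases Z) (auto simp: word_eq)
qed

lemma shrub_less_nth_relabel:
  assumes "strict_mono_on S h" "labels F \<subseteq> S" "i < length F" "j < length F"
  shows "shrub_less Z (map (relabel h) F ! i) (map (relabel h) F ! j)
           \<longleftrightarrow> shrub_less Z (F ! i) (F ! j)"
proof -
  have "set (word (F ! l)) \<subseteq> S" if "l < length F" for l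
    using set_word_subset_labels[of "F ! l" F] that assms(2) by auto
  with assms show ?thesis by (simp add: shrub_less_relabel)
qed

lemma ris_relabel:
  assumes "strict_mono_on S h" "labels F \<subseteq> S"
  shows "ris Z (map (relabel h) F) = ris Z F"
  unfolding ris_def
  by (rule arg_cong[where f = card]) (auto simp: shrub_less_nth_relabel[OF assms] simp del: nth_map)

lemma successively_relabel:
  assumes "strict_mono_on S h" "labels F \<subseteq> S"
  shows "successively (shrub_less Z) (map (relabel h) F) \<longleftrightarrow> successively (shrub_less Z) F"
  unfolding successively_conv_nth
  by (auto simp: shrub_less_nth_relabel[OF assms] simp del: nth_map)

text \<open>Monotonicity keeps the labels distinct and each root minimal in its shrub; positivity of
  the new labels has to be supplied by \<open>pos\<close>.\<close>

lemma relabel_in_forests_on: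
  assumes h: "strict_mono_on S h" and pos: "0 \<notin> h ` S" and F: "F \<in> forests_on S"
  shows "map (relabel h) F \<in> forests_on (h ` S)"
proof -
  have lab: "labels F = S" using F by (simp add: forests_on_def)
  have inj: "inj_on h S" using h by (rule strict_mono_on_imp_inj_on)
  have "binary_shrub (relabel h s)" if s: "s \<in> set F" for s
  proof -
    have sub: "set (word s) \<subseteq> S" using set_word_subset_labels[OF s] lab by simp
    have "binary_shrub s" using F s by (simp add: forests_on_def)
    then have "distinct (map h (word s))" "h (root s) < h (left s)" "h (root s) < h (right s)"
      using sub inj strict_mono_onD[OF h]
      by (auto simp: binary_shrub_def distinct_map word_eq inj_on_def)
    moreover have "0 < h k" if "k \<in> set (word s)" for k
      using that sub pos by (metis gr0I imageI subsetD)
    ultimately show ?thesis by (simp add: binary_shrub_def)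
  qed
  moreover have "distinct (concat (map word (map (relabel h) F)))"
    unfolding concat_word_relabel distinct_map using F inj lab
    by (simp add: forests_on_def labels_def)
  ultimately show ?thesis
    by (simp add: forests_on_def labels_relabel lab del: map_map)
qed

lemma relabel_inverse:
  assumes "\<And>k. k \<in> S \<Longrightarrow> g (h k) = k" "F \<in> forests_on S"
  shows "map (relabel g) (map (relabel h) F) = F"
proof -
  have "relabel g (relabel h s) = s" if "s \<in> set F" for s
    using set_word_subset_labels[OF that] assms
    by (cases s) (auto simp: forests_on_def relabel_def)
  then show ?thesis by (simp add: map_idI)
qed

text \<open>The inverse \<open>g\<close> of \<open>h\<close> is itself increasing on the image, so
  the previous lemmas apply in both directions. Each direction uses the positivity of its target
  label set.\<close>

lemma bij_betw_relabel:
  assumes h: "strict_mono_on S h" and S: "0 \<notin> S" and hS: "0 \<notin> h ` S"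
  shows "bij_betw (map (relabel h)) (forests_on S) (forests_on (h ` S))"
proof -
  define g where "g = inv_into S h"
  have inj: "inj_on h S" using h by (rule strict_mono_on_imp_inj_on)
  have gh: "g (h k) = k" if "k \<in> S" for k using that inj by (simp add: g_def)
  have img: "g ` h ` S = S" using gh by force
  have g: "strict_mono_on (h ` S) g"
    by (rule strict_mono_onI) (auto simp: gh strict_mono_on_less[OF h])
  show ?thesis
  proof (rule bij_betw_byWitness[where f' = "map (relabel g)"])
    show "\<forall>F\<in>forests_on S. map (relabel g) (map (relabel h) F) = F"
      using relabel_inverse gh by blast
    show "\<forall>F\<in>forests_on (h ` S). map (relabel h) (map (relabel g) F) = F"
    proof
      have "h (g k) = k" if "k \<in> h ` S" for k using that gh by auto
      then show "map (relabel h) (map (relabel g) F) = F" if "F \<in> forests_on (h ` S)" for F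
        using that by (rule relabel_inverse)
    qed
    show "map (relabel h) ` forests_on S \<subseteq> forests_on (h ` S)"
      using relabel_in_forests_on[OF h hS] by blast
    show "map (relabel g) ` forests_on (h ` S) \<subseteq> forests_on S"
      using relabel_in_forests_on[OF g] S unfolding img by blast
  qed
qed

text \<open>A statistic that sees only the relative order of labels has a total depending only on
  the size of the label set, because the increasing enumeration of \<open>S\<close> standardizes its
  forests to labels \<open>1\<close> up to \<open>3 * k\<close>.\<close>

lemma sum_forests_on_eq:
  fixes f :: "shrub list \<Rightarrow> 'a::comm_monoid_add"
  assumes S: "finite S" "0 \<notin> S" "card S = 3 * k"
    and f: "\<And>S h F. strict_mono_on S h \<Longrightarrow> labels F \<subseteq> S \<Longrightarrow> f (map (relabel h) F) = f F"
  shows "sum f (forests_on S) = sum f (forests k)"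
proof -
  obtain e where bij: "bij_betw e {..<3 * k} S" and e: "strict_mono_on {..<3 * k} e"
    using ex_bij_betw_strict_mono_card[OF S(1)] S(3) by metis
  \<comment> \<open>The enumeration \<open>e\<close> starts at 0 while standard labels start at 1,
    so the argument is shifted.\<close>
  define h where "h i = e (i - 1)" for i
  have "(\<lambda>i. i - 1) ` {1..3 * k} = {..<3 * k}"
    by (force simp: image_iff intro: bexI[where x = "Suc _"])
  moreover have "h ` {1..3 * k} = e ` (\<lambda>i. i - 1) ` {1..3 * k}"
    by (simp add: h_def image_image)
  ultimately have img: "h ` {1..3 * k} = S" using bij by (simp add: bij_betw_def)
  have h: "strict_mono_on {1..3 * k} h"
    by (rule strict_mono_onI) (auto simp: h_def intro!: strict_mono_onD[OF e])
  have "bij_betw (map (relabel h)) (forests k) (forests_on S)"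
    using bij_betw_relabel[OF h] S(2) unfolding img forests_eq_forests_on by simp
  then have "sum f (forests_on S) = (\<Sum>F\<in>forests k. f (map (relabel h) F))"
    by (rule sum.reindex_bij_betw[symmetric])
  also have "\<dots> = sum f (forests k)"
    by (intro sum.cong refl f[OF h]) (simp add: forests_eq_forests_on forests_on_def)
  finally show ?thesis .
qed

section \<open>Cutting a forest in two\<close>

lemma append_in_forests_on:
  assumes "G \<in> forests_on S" "H \<in> forests_on (U - S)" "S \<subseteq> U"
  shows "G @ H \<in> forests_on U"
  using assms by (auto simp: forests_on_def labels_def)

lemma split_forests_on:
  assumes "G @ H \<in> forests_on U"
  shows "labels G \<subseteq> U" "G \<in> forests_on (labels G)" "H \<in> forests_on (U - labels G)"
  using assms by (auto simp: forests_on_def labels_def)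

text \<open>Cutting after the first \<open>k\<close> shrubs is a bijection from forests on
  \<open>U\<close> to triples \<open>(S, G, H)\<close>, where \<open>S\<close> records the labels
  that fall into the first piece \<open>G\<close>; concatenation is its inverse.\<close>

lemma sum_forests_on_split:
  fixes f g :: "shrub list \<Rightarrow> 'a::comm_semiring_1"
  assumes U: "finite U" and k: "3 * k \<le> card U"
  shows "(\<Sum>F\<in>forests_on U. f (take k F) * g (drop k F)) =
         (\<Sum>S | S \<subseteq> U \<and> card S = 3 * k. sum f (forests_on S) * sum g (forests_on (U - S)))"
proof -
  let ?\<S> = "{S. S \<subseteq> U \<and> card S = 3 * k}"
  let ?P = "SIGMA S:?\<S>. forests_on S \<times> forests_on (U - S)"
  have finS: "finite S" if "S \<in> ?\<S>" for S using that U by (auto intro: finite_subset)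
  have len: "length G = k" if "S \<in> ?\<S>" "G \<in> forests_on S" for S G
    using length_forests_on[OF that(2)] that(1) by simp
  have "(\<Sum>F\<in>forests_on U. f (take k F) * g (drop k F)) = (\<Sum>(S, G, H)\<in>?P. f G * g H)"
  proof (rule sum.reindex_bij_witness[
      where i = "\<lambda>(S, G, H). G @ H" and j = "\<lambda>F. (labels (take k F), take k F, drop k F)"])
    fix F assume F: "F \<in> forests_on U"
    show "(case (labels (take k F), take k F, drop k F) of (S, G, H) \<Rightarrow> G @ H) = F" by simp
    have sp: "labels (take k F) \<subseteq> U" "take k F \<in> forests_on (labels (take k F))"
      "drop k F \<in> forests_on (U - labels (take k F))"
      using split_forests_on[of "take k F" "drop k F" U] F by simp_all
    \<comment> \<open>The bound \<open>k\<close> ensures that \<open>F\<close> has at least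
      \<open>k\<close> shrubs, so that the prefix is not shorter than \<open>k\<close>.\<close>
    moreover have "card (labels (take k F)) = 3 * k"
      using length_forests_on[OF sp(2)] length_forests_on[OF F] k by simp
    ultimately show "(labels (take k F), take k F, drop k F) \<in> ?P" by simp
  next
    fix p assume "p \<in> ?P"
    then obtain S G H where p: "p = (S, G, H)" "S \<in> ?\<S>" "G \<in> forests_on S" "H \<in> forests_on (U - S)"
      by auto
    have "labels G = S" using p(3) by (simp add: forests_on_def)
    then show "(labels (take k (case p of (S, G, H) \<Rightarrow> G @ H)), take k (case p of (S, G, H) \<Rightarrow> G @ H),
        drop k (case p of (S, G, H) \<Rightarrow> G @ H)) = p"
      using p len[OF p(2,3)] by simp
    show "(case p of (S, G, H) \<Rightarrow> G @ H) \<in> forests_on U"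
      using p append_in_forests_on by auto
  qed auto
  also have "\<dots> = (\<Sum>S\<in>?\<S>. \<Sum>(G, H)\<in>forests_on S \<times> forests_on (U - S). f G * g H)"
  proof (rule sum.Sigma[symmetric])
    show "finite ?\<S>" using U by simp
    show "\<forall>S\<in>?\<S>. finite (forests_on S \<times> forests_on (U - S))"
      using U finS by (blast intro: finite_forests_on finite_cartesian_product finite_Diff)
  qed
  also have "\<dots> = (\<Sum>S\<in>?\<S>. sum f (forests_on S) * sum g (forests_on (U - S)))"
    by (simp add: sum_product sum.cartesian_product)
  finally show ?thesis .
qed

text \<open>By relabelling invariance every choice of \<open>S\<close> contributes the same product,
  and the binomial coefficient counts these choices.\<close>

lemma sum_forests_split:
  fixes f g :: "shrub list \<Rightarrow> 'a::comm_semiring_1"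
  assumes k: "k \<le> n"
    and f: "\<And>S h F. strict_mono_on S h \<Longrightarrow> labels F \<subseteq> S \<Longrightarrow> f (map (relabel h) F) = f F"
    and g: "\<And>S h F. strict_mono_on S h \<Longrightarrow> labels F \<subseteq> S \<Longrightarrow> g (map (relabel h) F) = g F"
  shows "(\<Sum>F\<in>forests n. f (take k F) * g (drop k F)) =
         of_nat (3 * n choose (3 * k)) * (sum f (forests k) * sum g (forests (n - k)))"
proof -
  let ?U = "{1..3 * n}"
  have "(\<Sum>F\<in>forests n. f (take k F) * g (drop k F)) =
        (\<Sum>S | S \<subseteq> ?U \<and> card S = 3 * k. sum f (forests_on S) * sum g (forests_on (?U - S)))"
    unfolding forests_eq_forests_on using k by (intro sum_forests_on_split) auto
  also have "\<dots> = (\<Sum>S | S \<subseteq> ?U \<and> card S = 3 * k. sum f (forests k) * sum g (forests (n - k)))"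
  proof (rule sum.cong[OF refl])
    fix S assume "S \<in> {S. S \<subseteq> ?U \<and> card S = 3 * k}"
    then have S: "S \<subseteq> ?U" "card S = 3 * k" "finite S" by (auto intro: finite_subset)
    have "sum f (forests_on S) = sum f (forests k)"
      using S f by (intro sum_forests_on_eq) auto
    moreover have "sum g (forests_on (?U - S)) = sum g (forests (n - k))"
      using S g by (intro sum_forests_on_eq) (auto simp: card_Diff_subset)
    ultimately show "sum f (forests_on S) * sum g (forests_on (?U - S)) =
        sum f (forests k) * sum g (forests (n - k))" by simp
  qed
  also have "\<dots> = of_nat (3 * n choose (3 * k)) * (sum f (forests k) * sum g (forests (n - k)))"
    by (simp add: n_subsets)
  finally show ?thesis .
qed

section \<open>Expansion of \<open>x ^ ris Z F\<close> and the recurrence\<close>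

lemma ris_Nil [simp]: "ris Z [] = 0"
  by (simp add: ris_def)

lemma ris_Cons_Cons:
  "ris Z (s # s' # F) = (if shrub_less Z s s' then 1 else 0) + ris Z (s' # F)"
proof -
  let ?A = "\<lambda>F. {i. i + 1 < length F \<and> shrub_less Z (F ! i) (F ! (i + 1))}"
  \<comment> \<open>Position 0 is the new adjacent pair; all positions of the tail move up by
    one.\<close>
  have "?A (s # s' # F) = (if shrub_less Z s s' then {0} else {}) \<union> Suc ` ?A (s' # F)"
    (is "?L = ?R")
  proof (rule set_eqI)
    fix i show "i \<in> ?L \<longleftrightarrow> i \<in> ?R" by (cases i) (auto simp: image_iff)
  qed
  moreover have "finite (?A (s' # F))" by (rule finite_subset[of _ "{..<length (s' # F)}"]) auto
  ultimately show ?thesis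
    unfolding ris_def by (auto simp: card_image card_insert_if)
qed

text \<open>Induction on \<open>F\<close>: with \<open>r\<close> the number of rises of the tail,
  the term \<open>k = 1\<close> gives \<open>x ^ r\<close>, and the remaining terms are the
  expansion of the tail times \<open>x - 1\<close> if the first pair rises, and times 0 otherwise. A
  rise thus yields \<open>x ^ r + (x - 1) * x ^ r = x ^ (r + 1)\<close>. The empty list is excluded
  since its sum has no terms.\<close>

lemma power_ris_expand:
  fixes x :: "'a::comm_ring_1"
  assumes "F \<noteq> []"
  shows "x ^ ris Z F = (\<Sum>k = 1..length F.
    (x - 1) ^ (k - 1) * (of_bool (successively (shrub_less Z) (take k F)) * x ^ ris Z (drop k F)))"
  using assms
proof (induction F rule: induct_list012)
  case (3 s s' F)
  let ?t = "\<lambda>F k. (x - 1) ^ (k - 1) *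
    (of_bool (successively (shrub_less Z) (take k F)) * x ^ ris Z (drop k F))"
  have "(\<Sum>k = 1..length (s # s' # F). ?t (s # s' # F) k) =
      x ^ ris Z (s' # F) + (\<Sum>k = 1..length (s' # F). ?t (s # s' # F) (Suc k))"
    by (subst sum.atLeast_Suc_atMost) (simp_all add: sum.shift_bounds_cl_Suc_ivl del: sum.cl_ivl_Suc)
  also have "(\<Sum>k = 1..length (s' # F). ?t (s # s' # F) (Suc k)) =
      (\<Sum>k = 1..length (s' # F). of_bool (shrub_less Z s s') * (x - 1) * ?t (s' # F) k)"
  proof (rule sum.cong[OF refl])
    fix k assume "k \<in> {1..length (s' # F)}"
    \<comment> \<open>The successor form resolves the truncated exponent \<open>k - 1\<close> and
      exposes both \<open>s\<close> and \<open>s'\<close> in the prefix, so that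
      \<open>successively\<close> unfolds at the first pair.\<close>
    then obtain j where "k = Suc j" by (cases k) auto
    then show "?t (s # s' # F) (Suc k) = of_bool (shrub_less Z s s') * (x - 1) * ?t (s' # F) k"
      by simp
  qed
  also have "\<dots> = of_bool (shrub_less Z s s') * (x - 1) * x ^ ris Z (s' # F)"
    using "3.IH"(2) by (simp only: sum_distrib_left list.simps not_False_eq_True simp_thms)
  also have "x ^ ris Z (s' # F) + \<dots> = x ^ ris Z (s # s' # F)"
    by (simp add: ris_Cons_Cons algebra_simps)
  finally show ?case by (rule sym)
qed (simp_all add: ris_def)

text \<open>Turns the count into a sum of a relabelling-invariant statistic, the form required by
  \<open>sum_forests_split\<close>.\<close>

lemma IZF_eq_sum:
  "(of_nat (IZF Z n) :: 'a::semiring_1) = (\<Sum>F\<in>forests n. of_bool (successively (shrub_less Z) F))"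
proof -
  have "finite (forests n)" by (simp add: forests_eq_forests_on finite_forests_on)
  moreover have "{F \<in> forests n. \<forall>i. i + 1 < n \<longrightarrow> shrub_less Z (F ! i) (F ! (i + 1))} =
      forests n \<inter> {F. successively (shrub_less Z) F}"
    by (auto simp: successively_conv_nth forests_def)
  ultimately show ?thesis by (simp add: IZF_def sum_of_bool_eq)
qed

text \<open>After exchanging the sums over forests and over \<open>k\<close>, each inner sum factors
  through the cut at \<open>k\<close>: the indicator of an increasing prefix gives
  \<open>IZF Z k\<close>, the rest gives the total for \<open>n - k\<close> shrubs.\<close>

lemma ris_recurrence:
  fixes x :: "'a::comm_ring_1"
  assumes "0 < n"
  shows "(\<Sum>F\<in>forests n. x ^ ris Z F) = (\<Sum>k = 1..n. of_nat (3 * n choose (3 * k)) *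
    ((x - 1) ^ (k - 1) * of_nat (IZF Z k)) * (\<Sum>F\<in>forests (n - k). x ^ ris Z F))"
proof -
  let ?I = "\<lambda>F. of_bool (successively (shrub_less Z) F) :: 'a" and ?X = "\<lambda>F. x ^ ris Z F"
  have "(\<Sum>F\<in>forests n. ?X F) =
      (\<Sum>F\<in>forests n. \<Sum>k = 1..n. (x - 1) ^ (k - 1) * (?I (take k F) * ?X (drop k F)))"
  proof (rule sum.cong[OF refl])
    fix F assume "F \<in> forests n"
    then have "length F = n" by (simp add: forests_def)
    with assms show "?X F = (\<Sum>k = 1..n. (x - 1) ^ (k - 1) * (?I (take k F) * ?X (drop k F)))"
      using power_ris_expand[of F x Z] by auto
  qed
  also have "\<dots> =
      (\<Sum>k = 1..n. (x - 1) ^ (k - 1) * (\<Sum>F\<in>forests n. ?I (take k F) * ?X (drop k F)))"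
    by (subst sum.swap) (simp add: sum_distrib_left)
  also have "\<dots> = (\<Sum>k = 1..n. of_nat (3 * n choose (3 * k)) *
    ((x - 1) ^ (k - 1) * of_nat (IZF Z k)) * (\<Sum>F\<in>forests (n - k). ?X F))"
  proof (rule sum.cong[OF refl])
    fix k assume "k \<in> {1..n}"
    then have "(\<Sum>F\<in>forests n. ?I (take k F) * ?X (drop k F)) =
        of_nat (3 * n choose (3 * k)) * (sum ?I (forests k) * sum ?X (forests (n - k)))"
      by (intro sum_forests_split) (simp_all only: successively_relabel ris_relabel atLeastAtMost_iff)
    then show "(x - 1) ^ (k - 1) * (\<Sum>F\<in>forests n. ?I (take k F) * ?X (drop k F)) =
        of_nat (3 * n choose (3 * k)) * ((x - 1) ^ (k - 1) * of_nat (IZF Z k)) *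
        (\<Sum>F\<in>forests (n - k). ?X F)"
      by (simp add: IZF_eq_sum mult_ac)
  qed
  finally show ?thesis .
qed

section \<open>From the recurrence to the generating function\<close>

text \<open>Dividing the recurrence by \<open>(3n)!\<close> turns the binomial coefficient into
  \<open>1 / ((3k)! (3n - 3k)!)\<close>, so it says coefficientwise that
  \<open>A = 1 + B * A\<close>, that is, \<open>(1 - B) * A = 1\<close>.\<close>

lemma egf3_recurrence:
  includes fps_syntax
  fixes a b :: "nat \<Rightarrow> 'a::field_char_0"
  assumes a0: "a 0 = 1"
    and rec: "\<And>n. 0 < n \<Longrightarrow> a n = (\<Sum>k = 1..n. of_nat (3 * n choose (3 * k)) * b k * a (n - k))"
  shows "1 + egf3 a = 1 / (1 - egf3 b)"
proof -
  define A where "A = 1 + egf3 a"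
  define B where "B = egf3 b"
  \<comment> \<open>\<open>egf3\<close> has constant term 0; the added 1 supplies exactly the
    missing \<open>a 0\<close>.\<close>
  have A_nth: "A $ m = (if 3 dvd m then a (m div 3) / fact m else 0)" for m
    by (auto simp: A_def egf3_def a0)
  have B_nth: "B $ m = (if 0 < m \<and> 3 dvd m then b (m div 3) / fact m else 0)" for m
    by (simp add: B_def egf3_def)
  have "A $ m = (1 + B * A) $ m" for m
  proof (cases "0 < m \<and> 3 dvd m")
    case True
    then obtain n where m: "m = 3 * n" and n: "0 < n" by auto
    have "(B * A) $ m = (\<Sum>i = 0..m. B $ i * A $ (m - i))"
      by (rule fps_mult_nth)
    \<comment> \<open>\<open>B\<close> is supported on positive multiples of 3, which also removes
      the index 0.\<close>
    also have "\<dots> = (\<Sum>i\<in>(*) 3 ` {1..n}. B $ i * A $ (m - i))"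
    proof (rule sum.mono_neutral_right)
      show "\<forall>i\<in>{0..m} - (*) 3 ` {1..n}. B $ i * A $ (m - i) = 0"
        by (auto simp: B_nth m elim!: dvdE)
    qed (auto simp: m)
    also have "\<dots> = (\<Sum>k = 1..n. B $ (3 * k) * A $ (m - 3 * k))"
      by (subst sum.reindex) (auto simp: inj_on_def)
    also have "\<dots> = (\<Sum>k = 1..n. of_nat (3 * n choose (3 * k)) * b k * a (n - k) / fact m)"
    proof (rule sum.cong[OF refl])
      fix k assume k: "k \<in> {1..n}"
      then have "m - 3 * k = 3 * (n - k)" by (simp add: m)
      moreover have "(of_nat (3 * n choose (3 * k)) :: 'a) =
          fact m / (fact (3 * k) * fact (m - 3 * k))"
        using k unfolding m by (intro binomial_fact) simp
      ultimately show "B $ (3 * k) * A $ (m - 3 * k) =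
          of_nat (3 * n choose (3 * k)) * b k * a (n - k) / fact m"
        using k by (simp add: A_nth B_nth)
    qed
    also have "\<dots> = a n / fact m"
      by (simp add: rec[OF n] sum_divide_distrib)
    also have "\<dots> = A $ m" by (simp add: A_nth m)
    finally show ?thesis using n m by simp
  next
    case False
    show ?thesis
    proof (cases "m = 0")
      case True
      then show ?thesis by (simp add: A_nth B_nth a0)
    next
      case m: False
      with False have "\<not> 3 dvd m" by simp
      \<comment> \<open>If 3 divided both \<open>i\<close> and \<open>m - i\<close>, it would divide
        \<open>m\<close>; so one factor vanishes.\<close>
      then have "B $ i * A $ (m - i) = 0" if "i \<le> m" for i
        using that dvd_diffD[of 3 m i] by (auto simp: A_nth B_nth)
      then have "(B * A) $ m = 0" by (simp add: fps_mult_nth del: mult_eq_0_iff)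
      with m \<open>\<not> 3 dvd m\<close> show ?thesis using A_nth[of m] by simp
    qed
  qed
  then have "A = 1 + B * A" by (rule fps_ext)
  then have "(1 - B) * A = 1" by (simp add: algebra_simps)
  then have "inverse (1 - B) = A" by (rule fps_inverse_unique)
  moreover have "(1 - B) $ 0 \<noteq> 0" by (simp add: B_nth)
  ultimately show ?thesis by (simp add: fps_divide_unit A_def B_def)
qed

theorem theorem2:
  fixes Z :: shrub_order and x :: "'a::field_char_0"
  shows "1 + egf3 (\<lambda>n. \<Sum>F\<in>forests n. x ^ ris Z F) =
         1 / (1 - egf3 (\<lambda>n. (x - 1) ^ (n - 1) * of_nat (IZF Z n)))"
proof (rule egf3_recurrence)
  \<comment> \<open>The empty forest gives the initial value 1, which the term \<open>k = n\<close>
    of the recurrence uses.\<close>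
  have "forests 0 = {[]}" by (auto simp: forests_def)
  then show "(\<Sum>F\<in>forests 0. x ^ ris Z F) = 1" by simp
qed (rule ris_recurrence)

end
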